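(* Let $b:\mathbb{R}^n\to\mathbb{R}^n$ be a smooth vector field with Jacobian matrix $J(x)=Db(x)$, and consider the simplified gentlest ascent dynamics on pairs $(x,v)\in\mathbb{R}^n\times(\mathbb{R}^n\setminus\{0\})$, $$\dot{x}=b(x)-2\,\frac{\langle b(x),v\rangle}{\|v\|^2}\,v,\qquad \dot{v}=J(x)v-\langle v,J(x)v\rangle\, v. \qquad (\ast)$$ (a) If $(x_*,v_* )$ is a fixed point of $(\ast)$ with $\|v_*\|=1$, then $v_*$ is an eigenvector of $J(x_* )$ corresponding to some eigenvalue $\lambda_*$, i.e. $J(x_* )v_*=\lambda_*v_*$, and $x_*$ is a fixed point of $\dot{x}=b(x)$, i.e. $b(x_* )=0$. (b) Let $x_s$ be a fixed point of $\dot{x}=b(x)$. Suppose that $J(x_s)$ has $n$ distinct real eigenvalues $\lambda_1,\dots,\lambda_n$ with $n$ corresponding linearly independent eigenvectors $v_1,\dots,v_n$, i.e. $J(x_s)v_i=\lambda_iv_i$ and $\|v_i\|=1$ for $i=1,\dots,n$. Then $(x_s,v_i)$ is a fixed point of $(\ast)$ for every $i=1,\dots,n$. Furthermore, for $i'\in\{1,\dots,n\}$, the fixed point $(x_s,v_{i'})$ of $(\ast)$ is linearly stable if and only if $x_s$ is an index-1 saddle point of $\dot{x}=b(x)$ and the eigenvalue $\lambda_{i'}$ corresponding to $v_{i'}$ is the only positive eigenvalue of $J(x_s)$.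
   Context: $\langle\cdot,\cdot\rangle$ and $\|\cdot\|$ denote the Euclidean inner product and norm on $\mathbb{R}^n$. The Jacobian matrix is $J(x)_{ij}=\partial b_i/\partial x_j$; it is not assumed symmetric (the vector field need not be a gradient). A fixed point of an autonomous ODE is a zero of its right-hand side. A fixed point is linearly stable if all eigenvalues of the Jacobian matrix of the right-hand side at that point have negative real part; for $(\ast)$ this is the $2n\times 2n$ Jacobian with respect to $(x,v)$. A fixed point $x_s$ of $\dot{x}=b(x)$ is an index-1 saddle point if its unstable manifold is exactly one-dimensional, understood in the nondegenerate sense: $J(x_s)$ has exactly one eigenvalue with positive real part and all its other eigenvalues have negative real part. *)

theory Defs
  imports
    "HOL-Analysis.Analysis"
    "HOL-Computational_Algebra.Polynomial"
begin

primrec Ck_map :: "nat \<Rightarrow> ('a::euclidean_space \<Rightarrow> 'b::euclidean_space) \<Rightarrow> bool" where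
  "Ck_map 0 f \<longleftrightarrow> continuous_on UNIV f"
| "Ck_map (Suc k) f \<longleftrightarrow> (\<forall>x. f differentiable (at x)) \<and>
     (\<forall>h. Ck_map k (\<lambda>x. frechet_derivative f (at x) h))"

definition smooth_map :: "('a::euclidean_space \<Rightarrow> 'b::euclidean_space) \<Rightarrow> bool" where
  "smooth_map f \<longleftrightarrow> (\<forall>k. Ck_map k f)"

definition eigenvector_of :: "'a::field^'m^'m \<Rightarrow> 'a^'m \<Rightarrow> 'a \<Rightarrow> bool" where
  "eigenvector_of A v c \<longleftrightarrow> v \<noteq> 0 \<and> A *v v = c *s v"

definition eigenvalue_of :: "'a::field^'m^'m \<Rightarrow> 'a \<Rightarrow> bool" where
  "eigenvalue_of A c \<longleftrightarrow> (\<exists>v. eigenvector_of A v c)"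

definition charpoly_of :: "'a::comm_ring_1^'m^'m \<Rightarrow> 'a poly" where
  "charpoly_of A = det (mat [:0, 1:] - map_matrix (\<lambda>a. [:a:]) A)"

lemma eigenvalue_of_iff_poly:
  "eigenvalue_of A c \<longleftrightarrow> poly (charpoly_of A) c = 0"
proof -
  have *: "poly (charpoly_of A) c = det (mat c - A)"
    unfolding charpoly_of_def det_def poly_sum
    by (intro sum.cong refl)
       (auto simp: poly_prod mat_def sign_def intro!: prod.cong)
  have "(mat c - A) *v v = c *s v - A *v v" for v
    by (simp add: vec_eq_iff matrix_vector_mult_def mat_def left_diff_distrib sum_subtractf
        if_distrib[of "\<lambda>x. x * _"] cong: if_cong)
  then have "(mat c - A) *v v = 0 \<longleftrightarrow> A *v v = c *s v" for v
    by auto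
  then have "eigenvalue_of A c \<longleftrightarrow> \<not> invertible (mat c - A)"
    unfolding eigenvalue_of_def eigenvector_of_def invertible_left_inverse
      matrix_left_invertible_ker by auto
  with * show ?thesis
    by (simp add: invertible_det_nz)
qed

text \<open>Eigenvalues of a real matrix are taken over the complex numbers.\<close>

abbreviation complexify :: "real^'m^'k \<Rightarrow> complex^'m^'k" where
  "complexify A \<equiv> map_matrix complex_of_real A"

definition ode_fixed_point :: "('a \<Rightarrow> 'b::zero) \<Rightarrow> 'a \<Rightarrow> bool" where
  "ode_fixed_point f z \<longleftrightarrow> f z = 0"

definition linearly_stable :: "(real^'m \<Rightarrow> real^'m) \<Rightarrow> real^'m \<Rightarrow> bool" where
  "linearly_stable f z \<longleftrightarrow>
     (\<forall>\<mu>. eigenvalue_of (complexify (jacobian f (at z))) \<mu> \<longrightarrow> Re \<mu> < 0)"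

text \<open>The single eigenvalue with positive real part is required to be simple as a root of the
  characteristic polynomial, so that the unstable manifold is one-dimensional.\<close>

definition index1_saddle :: "(real^'m \<Rightarrow> real^'m) \<Rightarrow> real^'m \<Rightarrow> bool" where
  "index1_saddle f z \<longleftrightarrow> ode_fixed_point f z \<and>
     (\<exists>\<mu>. eigenvalue_of (complexify (jacobian f (at z))) \<mu> \<and> Re \<mu> > 0 \<and>
          order \<mu> (charpoly_of (complexify (jacobian f (at z)))) = 1 \<and>
          (\<forall>\<nu>. eigenvalue_of (complexify (jacobian f (at z))) \<nu> \<and> \<nu> \<noteq> \<mu> \<longrightarrow> Re \<nu> < 0))"

definition sgad :: "(real^'n \<Rightarrow> real^'n) \<Rightarrow> (real^'n) \<times> (real^'n) \<Rightarrow> (real^'n) \<times> (real^'n)" where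
  "sgad b = (\<lambda>(x, v).
     (b x - (2 * ((b x \<bullet> v) / (norm v)\<^sup>2)) *\<^sub>R v,
      jacobian b (at x) *v v - (v \<bullet> (jacobian b (at x) *v v)) *\<^sub>R v))"

text \<open>The phase space consists of the pairs with nonzero second component.\<close>

definition sgad_fixed_point :: "(real^'n \<Rightarrow> real^'n) \<Rightarrow> real^'n \<Rightarrow> real^'n \<Rightarrow> bool" where
  "sgad_fixed_point b x v \<longleftrightarrow> v \<noteq> 0 \<and> ode_fixed_point (sgad b) (x, v)"

text \<open>Stacking a pair into one vector with \<open>2 * CARD('n)\<close> coordinates, so that the Jacobian with
  respect to both components is a square matrix.\<close>

definition stack :: "(real^'n) \<times> (real^'n) \<Rightarrow> real^('n + 'n)" where
  "stack = (\<lambda>(x, v). \<chi> k. case k of Inl i \<Rightarrow> x $ i | Inr i \<Rightarrow> v $ i)"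

definition unstack :: "real^('n + 'n) \<Rightarrow> (real^'n) \<times> (real^'n)" where
  "unstack z = (\<chi> i. z $ Inl i, \<chi> i. z $ Inr i)"

definition sgad_linearly_stable :: "(real^'n \<Rightarrow> real^'n) \<Rightarrow> real^'n \<Rightarrow> real^'n \<Rightarrow> bool" where
  "sgad_linearly_stable b x v \<longleftrightarrow> linearly_stable (stack \<circ> sgad b \<circ> unstack) (stack (x, v))"

end

theory Submission
  imports Defs
begin

text \<open>
  Part (a) is a reflection argument: for a unit vector \<open>v\<close> the first component of the field is
  the image of \<open>b x\<close> under the reflection in the hyperplane orthogonal to \<open>v\<close>, so it vanishes
  only if \<open>b x\<close> does; the second component vanishes exactly if \<open>v\<close> is an eigenvector.

  For part (b), put \<open>J = Db(xs)\<close> and \<open>v = V i\<close>. Since \<open>b\<close> vanishes at \<open>xs\<close>, the derivative of the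
  field at \<open>(xs, v)\<close> sends \<open>(h, k)\<close> to
  \<open>((I - 2 v v\<^sup>T) J h, L h + D k)\<close> with \<open>D k = J k - (k \<bullet> J v + v \<bullet> J k) v - (v \<bullet> J v) k\<close> and some
  map \<open>L\<close> that involves second derivatives of \<open>b\<close>. It is block triangular, so \<open>L\<close> does not affect
  the spectrum. Both diagonal blocks are in turn triangular in the eigenbasis of \<open>J\<close>: they
  act on \<open>v\<close> by a scalar, and on every other \<open>V j\<close> by a scalar up to a multiple of \<open>v\<close>. Their
  eigenvalues are \<open>- lam i\<close> and \<open>lam j\<close> for the first block, \<open>- 2 * lam i\<close> and \<open>lam j - lam i\<close> for
  the second, with \<open>j \<noteq> i\<close> (lemma \<open>sgad_eigenvalues\<close>). All of them are negative iff
  \<open>lam i > 0\<close> and \<open>lam j < 0\<close> for \<open>j \<noteq> i\<close>. As the \<open>lam j\<close> are distinct, hence simple roots of the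
  characteristic polynomial, this is the index-1 condition with \<open>lam i\<close> as the positive
  eigenvalue (lemma \<open>index1_saddle_unique_positive_iff\<close>).

  Both spectra, of \<open>J\<close> and of the stacked Jacobian, come from one fact of linear algebra, lemma
  \<open>charpoly_of_flag\<close>: a real matrix that is triangular with respect to some basis, ordered by
  an arbitrary ranking, has the diagonal entries as its complex eigenvalues with multiplicity.
\<close>

section \<open>Characteristic polynomials of triangularizable matrices\<close>

text \<open>
  Index types of matrices carry no linear order, so triangularity is expressed by a ranking of
  the indices. A permutation \<open>p\<close> that contributes to the determinant never decreases the rank;
  since it preserves the sum of all ranks it preserves every rank, and so it is the identity.
\<close>

lemma det_triangular_wrt_rank:
  fixes A :: "'a::comm_ring_1^'m^'m" and r :: "'m \<Rightarrow> nat"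
  assumes A: "\<And>l k. A $ l $ k \<noteq> 0 \<Longrightarrow> l \<noteq> k \<Longrightarrow> r l < r k"
  shows "det A = (\<Prod>k\<in>UNIV. A $ k $ k)"
proof -
  have "(\<Prod>i\<in>UNIV. A $ i $ p i) = 0" if p: "p permutes UNIV" and "p \<noteq> id" for p :: "'m \<Rightarrow> 'm"
  proof (rule ccontr)
    assume nz: "(\<Prod>i\<in>UNIV. A $ i $ p i) \<noteq> 0"
    have "A $ i $ p i \<noteq> 0" for i
      using nz prod_zero[of "UNIV :: 'm set" "\<lambda>i. A $ i $ p i"] by auto
    then have lt: "r i < r (p i)" if "i \<noteq> p i" for i
      using A that by blast
    have "(\<Sum>i\<in>UNIV. r i) = (\<Sum>i\<in>UNIV. r (p i))"
      using sum.permute[OF p, of r] by (simp add: o_def)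
    moreover have "r i \<le> r (p i)" for i
      by (cases "i = p i") (auto dest: lt)
    ultimately have "r i = r (p i)" for i
      by (rule sum_mono_inv) auto
    with lt have "p i = i" for i
      by (metis less_irrefl)
    with \<open>p \<noteq> id\<close> show False by auto
  qed
  then have "det A = (\<Sum>p\<in>{id}. of_int (sign p) * (\<Prod>i\<in>UNIV. A $ i $ p i))"
    unfolding det_def
    by (intro sum.mono_neutral_right) (auto simp: permutes_id)
  then show ?thesis by (simp add: sign_id)
qed

lemma map_matrix_matrix_mult:
  fixes f :: "'a::semiring_1 \<Rightarrow> 'b::semiring_1"
  assumes "f 0 = 0" "\<And>x y. f (x + y) = f x + f y" "\<And>x y. f (x * y) = f x * f y"
  shows "map_matrix f (A ** B) = map_matrix f A ** map_matrix f B"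
  by (simp add: vec_eq_iff matrix_matrix_mult_def assms(3)
      sum_comp_morphism[of f, OF assms(1,2), symmetric, unfolded o_def])

lemma map_matrix_mat_one:
  assumes "f 0 = 0" "f 1 = 1"
  shows "map_matrix f (mat 1) = mat 1"
  using assms by (simp add: vec_eq_iff mat_def)

lemma matrix_diff_distrib:
  fixes A A' :: "'a::ring_1^'n^'m" and B B' :: "'a^'p^'n"
  shows "(A - A') ** B = A ** B - A' ** B" and "A ** (B - B') = A ** B - A ** B'"
  by (simp_all add: vec_eq_iff matrix_matrix_mult_def algebra_simps sum_subtractf)

text \<open>
  The conjugation is carried out over the ring of polynomials, where constant matrices still
  commute with the scalar matrix \<open>X I\<close> and the determinant of \<open>P\<close> can be cancelled.
\<close>

lemma charpoly_of_similar:
  fixes M T P Q :: "'a::field^'m^'m"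
  assumes conj: "M ** P = P ** T" and inv: "P ** Q = mat 1"
  shows "charpoly_of M = charpoly_of T"
proof -
  define C :: "'a^'m^'m \<Rightarrow> 'a poly^'m^'m" where "C = map_matrix (\<lambda>a. [:a:])"
  have C_mult: "C (A ** B) = C A ** C B" for A B
    unfolding C_def by (rule map_matrix_matrix_mult) auto
  have "det (C P) * det (C Q) = 1"
    using arg_cong[OF inv, of C]
    by (simp add: C_mult flip: det_mul) (simp add: C_def map_matrix_mat_one)
  then have nz: "det (C P) \<noteq> 0" by auto
  have comm: "mat x ** C P = C P ** mat x" for x
    by (simp add: vec_eq_iff matrix_matrix_mult_def mat_def if_distrib if_distribR mult.commute
        cong: if_cong)
  have "(mat [:0, 1:] - C M) ** C P = C P ** (mat [:0, 1:] - C T)"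
    by (simp add: matrix_diff_distrib comm conj flip: C_mult)
  from arg_cong[OF this, of det] nz show ?thesis
    by (simp add: charpoly_of_def det_mul C_def)
qed

lemma charpoly_of_triangular_wrt_rank:
  fixes T :: "'a::comm_ring_1^'m^'m" and r :: "'m \<Rightarrow> nat"
  assumes "\<And>l k. T $ l $ k \<noteq> 0 \<Longrightarrow> l \<noteq> k \<Longrightarrow> r l < r k"
  shows "charpoly_of T = (\<Prod>k\<in>UNIV. [:- (T $ k $ k), 1:])"
  unfolding charpoly_of_def
  by (subst det_triangular_wrt_rank[of _ r]) (use assms in \<open>auto simp: mat_def split: if_splits\<close>)

lemma span_finite_image_coeffs:
  fixes B :: "'i \<Rightarrow> 'a::real_vector"
  assumes "finite S" "x \<in> span (B ` S)"
  shows "\<exists>c. x = (\<Sum>l\<in>S. c l *\<^sub>R B l)"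
  using assms
proof (induction S arbitrary: x)
  case (insert a S)
  then obtain k where "x - k *\<^sub>R B a \<in> span (B ` S)"
    by (auto simp: span_breakdown_eq)
  then obtain c where "x - k *\<^sub>R B a = (\<Sum>l\<in>S. c l *\<^sub>R B l)"
    using insert.IH by blast
  then have "x = (\<Sum>l\<in>insert a S. (c(a := k)) l *\<^sub>R B l)"
    using insert.hyps by (simp add: algebra_simps) (auto intro!: sum.cong)
  then show ?case by blast
qed auto

text \<open>
  Column \<open>k\<close> of the triangular matrix \<open>T\<close> holds the coordinates of \<open>M *v B k\<close> in the basis \<open>B\<close>. The
  triangularization is real, and complexifying it entrywise gives one of \<open>complexify M\<close>. Hence
  no complex eigenvectors have to be examined.
\<close>

theorem charpoly_of_flag:
  fixes M :: "real^'m^'m" and B :: "'m \<Rightarrow> real^'m" and d :: "'m \<Rightarrow> real" and r :: "'m \<Rightarrow> nat"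
  assumes span: "span (range B) = UNIV"
    and flag: "\<And>k. M *v B k - d k *\<^sub>R B k \<in> span (B ` {l. r l < r k})"
  shows "charpoly_of M = (\<Prod>k\<in>UNIV. [:- d k, 1:])"
    and "charpoly_of (complexify M) = (\<Prod>k\<in>UNIV. [:- complex_of_real (d k), 1:])"
proof -
  have "\<forall>k. \<exists>c. M *v B k - d k *\<^sub>R B k = (\<Sum>l | r l < r k. c l *\<^sub>R B l)"
    using flag by (intro allI span_finite_image_coeffs) auto
  then obtain c where c: "\<And>k. M *v B k - d k *\<^sub>R B k = (\<Sum>l | r l < r k. c k l *\<^sub>R B l)"
    by metis
  define P :: "real^'m^'m" where "P = (\<chi> a k. B k $ a)"
  define T :: "real^'m^'m" where
    "T = (\<chi> l k. if l = k then d k else if r l < r k then c k l else 0)"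
  have T_sum: "(\<Sum>l\<in>UNIV. T $ l $ k *\<^sub>R B l) = M *v B k" for k
  proof -
    have "(\<Sum>l\<in>UNIV. T $ l $ k *\<^sub>R B l)
        = (\<Sum>l\<in>UNIV. (if l = k then d k *\<^sub>R B l else 0) + (if r l < r k then c k l *\<^sub>R B l else 0))"
      by (intro sum.cong) (auto simp: T_def)
    also have "\<dots> = d k *\<^sub>R B k + (\<Sum>l | r l < r k. c k l *\<^sub>R B l)"
      by (simp add: sum.distrib sum.If_cases)
    finally show ?thesis by (simp flip: c)
  qed
  have conj: "M ** P = P ** T"
  proof -
    have "(M ** P) $ a $ k = (P ** T) $ a $ k" for a k
      using arg_cong[OF T_sum[of k], of "\<lambda>x. x $ a"]
      by (simp add: P_def matrix_matrix_mult_def matrix_vector_mult_def mult.commute)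
    then show ?thesis by (simp add: vec_eq_iff)
  qed
  have "columns P = range B"
    by (auto simp: columns_def column_def P_def vec_lambda_eta)
  with span obtain Q where inv: "P ** Q = mat 1"
    using matrix_right_invertible_span_columns[of P] by (auto simp: span_vec_eq)
  have T: "r l < r k" if "T $ l $ k \<noteq> 0" "l \<noteq> k" for l k
    using that by (auto simp: T_def split: if_splits)
  have T_diag: "T $ k $ k = d k" for k
    by (simp add: T_def)
  show "charpoly_of M = (\<Prod>k\<in>UNIV. [:- d k, 1:])"
    using charpoly_of_similar[OF conj inv] charpoly_of_triangular_wrt_rank[of T r, OF T]
    by (simp add: T_diag)
  have complexify_mult: "complexify (X ** Y) = complexify X ** complexify Y" for X Y :: "real^'m^'m"
    by (rule map_matrix_matrix_mult) auto
  have "complexify M ** complexify P = complexify P ** complexify T"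
    by (simp add: conj flip: complexify_mult)
  moreover have "complexify P ** complexify Q = mat 1"
    by (simp add: inv map_matrix_mat_one flip: complexify_mult)
  ultimately have "charpoly_of (complexify M) = charpoly_of (complexify T)"
    by (rule charpoly_of_similar)
  also have "\<dots> = (\<Prod>k\<in>UNIV. [:- (complexify T $ k $ k), 1:])"
    by (rule charpoly_of_triangular_wrt_rank[of _ r]) (auto intro: T)
  finally show "charpoly_of (complexify M) = (\<Prod>k\<in>UNIV. [:- complex_of_real (d k), 1:])"
    by (simp add: T_diag)
qed

corollary eigenvalue_of_flag:
  fixes M :: "real^'m^'m" and B :: "'m \<Rightarrow> real^'m" and d :: "'m \<Rightarrow> real" and r :: "'m \<Rightarrow> nat"
  assumes "span (range B) = UNIV"
    and "\<And>k. M *v B k - d k *\<^sub>R B k \<in> span (B ` {l. r l < r k})"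
  shows "eigenvalue_of M x \<longleftrightarrow> (\<exists>k. x = d k)"
    and "eigenvalue_of (complexify M) \<mu> \<longleftrightarrow> (\<exists>k. \<mu> = complex_of_real (d k))"
  using charpoly_of_flag[of B M d r, OF assms]
  by (auto simp: eigenvalue_of_iff_poly poly_prod)

lemma order_prod_distinct_linear:
  fixes d :: "'i::finite \<Rightarrow> 'a::field"
  assumes "inj d"
  shows "order (d i) (\<Prod>k\<in>UNIV. [:- d k, 1:]) = 1"
proof -
  let ?q = "\<Prod>k\<in>UNIV - {i}. [:- d k, 1:]"
  have split: "(\<Prod>k\<in>UNIV. [:- d k, 1:]) = [:- d i, 1:] * ?q"
    by (rule prod.remove) auto
  have "order (d i) ?q = 0"
    by (rule order_0I) (use injD[OF assms] in \<open>auto simp: poly_prod\<close>)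
  moreover have "order (d i) [:- d i, 1:] = 1"
    using order_power_n_n[of "d i" 1] by simp
  moreover have nz: "[:- d i, 1:] * ?q \<noteq> 0"
    by (simp only: mult_eq_0_iff prod_zero_iff finite) auto
  ultimately show ?thesis
    unfolding split order_mult[OF nz] by simp
qed

section \<open>The linearized dynamics\<close>

lemma stack_linear: "linear (stack :: (real^'n) \<times> (real^'n) \<Rightarrow> _)"
  by (rule linearI) (auto simp: stack_def vec_eq_iff split: sum.split)

lemma unstack_linear: "linear (unstack :: _ \<Rightarrow> (real^'n) \<times> (real^'n))"
  by (rule linearI) (auto simp: unstack_def vec_eq_iff)

lemma unstack_stack [simp]: "unstack (stack z) = z"
  by (cases z) (simp add: stack_def unstack_def vec_lambda_eta)

lemma stack_unstack [simp]: "stack (unstack w) = w"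
  by (auto simp: stack_def unstack_def vec_eq_iff split: sum.split)

lemma jacobian_eqI:
  fixes f :: "real^'n \<Rightarrow> real^'m"
  assumes "(f has_derivative f') (at x)"
  shows "jacobian f (at x) *v h = f' h"
proof -
  have "f differentiable at x"
    using assms differentiableI by blast
  then have "(f has_derivative (\<lambda>h. jacobian f (at x) *v h)) (at x)"
    by (simp only: jacobian_works)
  from has_derivative_unique[OF this assms] show ?thesis by metis
qed

lemma smooth_map_differentiable: "smooth_map f \<Longrightarrow> f differentiable at x"
  unfolding smooth_map_def by (metis Ck_map.simps(2))

lemma smooth_map_jacobian_differentiable:
  fixes f :: "real^'n \<Rightarrow> real^'m"
  assumes "smooth_map f"
  shows "(\<lambda>x. jacobian f (at x) *v h) differentiable at x"
proof -
  have "Ck_map (Suc (Suc 0)) f"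
    using assms by (auto simp: smooth_map_def)
  then have "(\<lambda>x. frechet_derivative f (at x) h) differentiable at x"
    unfolding Ck_map.simps by blast
  moreover have "frechet_derivative f (at x) h = jacobian f (at x) *v h" for x
    using smooth_map_differentiable[OF assms] frechet_derivative_works jacobian_eqI by metis
  ultimately show ?thesis by simp
qed

text \<open>
  The derivative in \<open>x\<close> is a second derivative of \<open>b\<close>. Only its existence matters, because
  it ends up in the off-diagonal block of the linearization.
\<close>

lemma has_derivative_jacobian_action:
  fixes f :: "real^'n \<Rightarrow> real^'n"
  assumes "smooth_map f"
  obtains L where "((\<lambda>z. jacobian f (at (fst z)) *v snd z) has_derivative
      (\<lambda>z. L (fst z) + jacobian f (at x) *v snd z)) (at (x, v))"
proof -
  define g where "g j y = jacobian f (at y) *v axis j 1" for j y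
  have "\<forall>j. \<exists>g'. (g j has_derivative g') (at x)"
    using smooth_map_jacobian_differentiable[OF assms] unfolding g_def differentiable_def by blast
  then obtain g' where g': "\<And>j. (g j has_derivative g' j) (at x)" by metis
  \<comment> \<open>Smoothness is a statement about each fixed direction; expanding the vector in coordinates
     reduces the joint derivative to the product rule.\<close>
  have expand: "jacobian f (at y) *v w = (\<Sum>j\<in>UNIV. w $ j *\<^sub>R g j y)" for y w
    unfolding g_def matrix_vector_mult_basis
    by (simp add: matrix_mult_sum scalar_mult_eq_scaleR)
  have "((\<lambda>z. g j (fst z)) has_derivative (\<lambda>z. g' j (fst z))) (at (x, v))" for j
    by (rule has_derivative_compose[OF has_derivative_fst[OF has_derivative_ident]])
       (use g' in simp)
  moreover have "((\<lambda>z. snd z $ j) has_derivative (\<lambda>z. snd z $ j)) (at (x, v))" for j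
    by (intro bounded_linear_imp_has_derivative bounded_linear_compose[OF bounded_linear_vec_nth]
        bounded_linear_snd)
  ultimately have "((\<lambda>z. \<Sum>j\<in>UNIV. snd z $ j *\<^sub>R g j (fst z)) has_derivative
      (\<lambda>z. \<Sum>j\<in>UNIV. v $ j *\<^sub>R g' j (fst z) + snd z $ j *\<^sub>R g j x)) (at (x, v))"
    by (auto intro!: derivative_eq_intros simp: ac_simps)
  then show thesis
    by (intro that[of "\<lambda>h. \<Sum>j\<in>UNIV. v $ j *\<^sub>R g' j h"]) (simp add: expand sum.distrib)
qed

text \<open>
  The block triangular form of the derivative of the dynamics at \<open>(x, v)\<close> with \<open>b x = 0\<close>: here
  \<open>J\<close> stands for the Jacobian of \<open>b\<close> at \<open>x\<close>, and \<open>L\<close> for the block that couples \<open>h\<close> into the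
  second component.
\<close>

definition sgad_linearization ::
    "real^'n^'n \<Rightarrow> (real^'n \<Rightarrow> real^'n) \<Rightarrow> real^'n \<Rightarrow> (real^'n) \<times> (real^'n) \<Rightarrow> (real^'n) \<times> (real^'n)"
  where "sgad_linearization J L v = (\<lambda>(h, k).
    (J *v h - (2 * ((J *v h) \<bullet> v)) *\<^sub>R v,
     L h + (J *v k - (k \<bullet> (J *v v) + v \<bullet> (J *v k)) *\<^sub>R v - (v \<bullet> (J *v v)) *\<^sub>R k)))"

text \<open>
  At a zero of \<open>b\<close> the terms in which the factor \<open>b\<close> stays undifferentiated drop out, so the first
  component of the derivative depends on \<open>h\<close> alone.
\<close>

lemma has_derivative_sgad:
  fixes b :: "real^'n \<Rightarrow> real^'n"
  assumes smooth: "smooth_map b" and b0: "b x = 0" and v: "norm v = 1"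
  defines "J \<equiv> jacobian b (at x)"
  obtains L where "(sgad b has_derivative sgad_linearization J L v) (at (x, v))"
proof -
  have vv: "v \<bullet> v = 1"
    using v by (simp add: norm_eq_1)
  obtain L where L: "((\<lambda>z. jacobian b (at (fst z)) *v snd z) has_derivative
      (\<lambda>z. L (fst z) + J *v snd z)) (at (x, v))"
    by (rule has_derivative_jacobian_action[OF smooth, of x v, folded J_def]) (rule that)
  have b_x: "(b has_derivative (\<lambda>h. J *v h)) (at x)"
    unfolding J_def using smooth_map_differentiable[OF smooth] by (simp only: jacobian_works)
  have b': "((\<lambda>z. b (fst z)) has_derivative (\<lambda>z. J *v fst z)) (at (x, v))"
    by (rule has_derivative_compose[OF has_derivative_fst[OF has_derivative_ident], where g = b])
      (use b_x in simp)
  have snd': "(snd has_derivative snd) (at (x, v))"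
    by (intro bounded_linear_imp_has_derivative bounded_linear_snd)
  have q: "((\<lambda>z. (b (fst z) \<bullet> snd z) / (snd z \<bullet> snd z))
      has_derivative (\<lambda>z. (J *v fst z) \<bullet> v)) (at (x, v))"
    using has_derivative_divide[OF has_derivative_inner[OF b' snd']
        has_derivative_inner[OF snd' snd']]
    by (simp add: vv b0)
  have 1: "((\<lambda>z. b (fst z) - (2 * ((b (fst z) \<bullet> snd z) / (snd z \<bullet> snd z))) *\<^sub>R snd z)
      has_derivative (\<lambda>z. J *v fst z - (2 * ((J *v fst z) \<bullet> v)) *\<^sub>R v)) (at (x, v))"
    using has_derivative_diff[OF b' has_derivative_scaleR[OF has_derivative_mult_right[OF q, of 2] snd']]
    by (simp add: b0)
  have 2: "((\<lambda>z. jacobian b (at (fst z)) *v snd z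
            - (snd z \<bullet> (jacobian b (at (fst z)) *v snd z)) *\<^sub>R snd z)
      has_derivative (\<lambda>z. (L (fst z) - (v \<bullet> L (fst z)) *\<^sub>R v) + (J *v snd z
         - (snd z \<bullet> (J *v v) + v \<bullet> (J *v snd z)) *\<^sub>R v - (v \<bullet> (J *v v)) *\<^sub>R snd z))) (at (x, v))"
    by (rule has_derivative_eq_rhs[OF has_derivative_diff[OF L
            has_derivative_scaleR[OF has_derivative_inner[OF snd' L] snd']]])
      (simp add: fun_eq_iff inner_add_right scaleR_add_left J_def)
  show thesis
    using has_derivative_Pair[OF 1 2] that[of "\<lambda>h. L h - (v \<bullet> L h) *\<^sub>R v"]
    by (simp add: sgad_def sgad_linearization_def case_prod_unfold power2_norm_eq_inner)
qed

text \<open>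
  In the basis formed by the \<open>(V j, 0)\<close> and the \<open>(0, V j)\<close> the linearization is triangular for
  the ranking \<open>(0, V i) < (0, V j) < (V i, 0) < (V j, 0)\<close> with \<open>j \<noteq> i\<close>. Vectors of the same rank
  do not interact, apart from each being scaled.
\<close>

theorem sgad_eigenvalues:
  fixes b :: "real^'n \<Rightarrow> real^'n" and lam :: "'n \<Rightarrow> real" and V :: "'n \<Rightarrow> real^'n"
  assumes smooth: "smooth_map b" and b0: "b x = 0"
    and span: "span (range V) = UNIV"
    and eig: "\<And>j. jacobian b (at x) *v V j = lam j *\<^sub>R V j"
    and norm: "norm (V i) = 1"
  shows "eigenvalue_of
      (complexify (jacobian (stack \<circ> sgad b \<circ> unstack) (at (stack (x, V i))))) \<mu> \<longleftrightarrow>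
    (\<exists>j. \<mu> = of_real (if j = i then - lam i else lam j)
       \<or> \<mu> = of_real (if j = i then - 2 * lam i else lam j - lam i))"
proof -
  define J where "J = jacobian b (at x)"
  define M where "M = jacobian (stack \<circ> sgad b \<circ> unstack) (at (stack (x, V i)))"
  define E1 :: "real^'n \<Rightarrow> real^('n + 'n)" where "E1 h = stack (h, 0)" for h
  define E2 :: "real^'n \<Rightarrow> real^('n + 'n)" where "E2 k = stack (0, k)" for k
  have linear_E: "linear E1" "linear E2"
    unfolding E1_def E2_def
    by (auto intro!: linearI simp: stack_def vec_eq_iff split: sum.split)
  have stack_E: "stack (h, k) = E1 h + E2 k" for h k
    using linear_add[OF stack_linear, of "(h, 0)" "(0, k)"] by (simp add: E1_def E2_def)
  have VV: "V i \<bullet> V i = 1"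
    using norm by (simp add: norm_eq_1)
  have JV: "J *v V j = lam j *\<^sub>R V j" for j
    using eig by (simp add: J_def)
  obtain L where L: "(sgad b has_derivative sgad_linearization J L (V i)) (at (x, V i))"
    by (rule has_derivative_sgad[OF smooth b0 norm, folded J_def]) (rule that)
  define D where "D = sgad_linearization J L (V i)"
  have D: "(sgad b has_derivative D) (at (x, V i))"
    using L by (simp add: D_def)
  have "((\<lambda>w. sgad b (unstack w)) has_derivative (\<lambda>w. D (unstack w))) (at (stack (x, V i)))"
    by (rule has_derivative_compose[OF linear_imp_has_derivative[OF unstack_linear], where g = "sgad b"])
       (use D in simp)
  then have F: "((\<lambda>w. stack (sgad b (unstack w))) has_derivative (\<lambda>w. stack (D (unstack w))))
      (at (stack (x, V i)))"
    by (rule has_derivative_compose[OF _ linear_imp_has_derivative[OF stack_linear]])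
  then have M: "M *v stack z = stack (D z)" for z
    using jacobian_eqI[OF F, of "stack z"] by (simp add: M_def o_def)
  have "D 0 = 0"
    using has_derivative_linear[OF D] by (rule linear_0)
  then have L0: "L 0 = 0"
    by (simp add: D_def sgad_linearization_def zero_prod_def)
  have ME1: "M *v E1 (V j) = lam j *\<^sub>R E1 (V j)
      - (2 * lam j * (V j \<bullet> V i)) *\<^sub>R E1 (V i) + E2 (L (V j))" for j
    unfolding E1_def M
    by (simp add: D_def sgad_linearization_def stack_E JV linear_diff[OF linear_E(1)] linear_scale[OF linear_E(1)]
       linear_0[OF linear_E(2)] flip: E1_def)
  have ME2: "M *v E2 (V j) = (lam j - lam i) *\<^sub>R E2 (V j)
      - ((lam i + lam j) * (V j \<bullet> V i)) *\<^sub>R E2 (V i)" for j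
    unfolding E2_def M
    by (simp add: D_def sgad_linearization_def stack_E JV VV L0 linear_add[OF linear_E(2)] linear_diff[OF linear_E(2)] linear_scale[OF linear_E(2)]
       linear_0[OF linear_E(1)] inner_commute algebra_simps flip: E2_def)
  define B :: "'n + 'n \<Rightarrow> real^('n + 'n)" where
    "B = case_sum (\<lambda>j. E1 (V j)) (\<lambda>j. E2 (V j))"
  define d where
    "d = case_sum (\<lambda>j. if j = i then - lam i else lam j)
                  (\<lambda>j. if j = i then - 2 * lam i else lam j - lam i)"
  define r :: "'n + 'n \<Rightarrow> nat" where
    "r = case_sum (\<lambda>j. if j = i then 2 else 3) (\<lambda>j. if j = i then 0 else 1)"
  have E2_span: "E2 k \<in> span ((\<lambda>j. E2 (V j)) ` UNIV)" for k
    using span linear_span_image[OF linear_E(2), of "range V"] by (auto simp: image_image)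
  have E1_span: "E1 k \<in> span ((\<lambda>j. E1 (V j)) ` UNIV)" for k
    using span linear_span_image[OF linear_E(1), of "range V"] by (auto simp: image_image)
  have span_B: "span (range B) = UNIV"
  proof -
    have "E1 h \<in> span (range B)" for h
      by (rule subsetD[OF span_mono E1_span]) (auto simp: B_def intro: range_eqI[of _ _ "Inl _"])
    moreover have "E2 k \<in> span (range B)" for k
      by (rule subsetD[OF span_mono E2_span]) (auto simp: B_def intro: range_eqI[of _ _ "Inr _"])
    ultimately have "stack (h, k) \<in> span (range B)" for h k
      unfolding stack_E by (rule span_add)
    then show ?thesis
      by (metis UNIV_eq_I stack_unstack surj_pair)
  qed
  \<comment> \<open>For \<open>j = i\<close> the multiple of \<open>V i\<close> in \<open>ME1\<close> and \<open>ME2\<close> belongs to the diagonal entry instead of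
     the span: \<open>lam i - 2 * lam i = - lam i\<close> and \<open>(lam i - lam i) - (lam i + lam i) = - 2 * lam i\<close>.
     The conditionals below separate this case.\<close>
  have flag: "M *v B s - d s *\<^sub>R B s \<in> span (B ` {l. r l < r s})" (is "_ \<in> ?S s") for s
  proof (cases s)
    case (Inl j)
    have E2: "E2 k \<in> ?S s" for k
      by (rule subsetD[OF span_mono E2_span])
         (auto simp: B_def r_def Inl intro: image_eqI[of _ _ "Inr _"])
    have "E1 (V i) \<in> ?S s" if "j \<noteq> i"
      by (rule span_base) (use that in \<open>auto simp: B_def r_def Inl intro: image_eqI[of _ _ "Inl i"]\<close>)
    then have "(if j = i then 0 else - (2 * lam j * (V j \<bullet> V i)) *\<^sub>R E1 (V i)) + E2 (L (V j)) \<in> ?S s"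
      by (intro span_add E2) (auto intro: span_scale span_neg span_zero)
    also have "(if j = i then 0 else - (2 * lam j * (V j \<bullet> V i)) *\<^sub>R E1 (V i)) + E2 (L (V j))
        = M *v B s - d s *\<^sub>R B s"
      by (simp add: B_def d_def Inl ME1 VV algebra_simps flip: scaleR_add_left)
    finally show ?thesis .
  next
    case (Inr j)
    have "E2 (V i) \<in> ?S s" if "j \<noteq> i"
      by (rule span_base) (use that in \<open>auto simp: B_def r_def Inr intro: image_eqI[of _ _ "Inr i"]\<close>)
    then have "(if j = i then 0 else - ((lam i + lam j) * (V j \<bullet> V i)) *\<^sub>R E2 (V i)) \<in> ?S s"
      by (auto intro: span_scale span_neg span_zero)
    also have "(if j = i then 0 else - ((lam i + lam j) * (V j \<bullet> V i)) *\<^sub>R E2 (V i))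
        = M *v B s - d s *\<^sub>R B s"
      by (simp add: B_def d_def Inr ME2 VV algebra_simps flip: scaleR_add_left)
    finally show ?thesis .
  qed
  have "eigenvalue_of (complexify M) \<mu> \<longleftrightarrow> (\<exists>s. \<mu> = complex_of_real (d s))"
    by (rule eigenvalue_of_flag(2)[OF span_B flag])
  also have "\<dots> \<longleftrightarrow> (\<exists>j. \<mu> = of_real (d (Inl j)) \<or> \<mu> = of_real (d (Inr j)))"
    by (metis sum.exhaust)
  finally show ?thesis
    by (simp add: M_def d_def)
qed

section \<open>Fixed points and their stability\<close>

lemma sgad_fixed_pointD:
  assumes fp: "sgad_fixed_point b x v" and v: "norm v = 1"
  shows "b x = 0" and "eigenvector_of (jacobian b (at x)) v (v \<bullet> (jacobian b (at x) *v v))"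
proof -
  have vv: "v \<bullet> v = 1"
    using v by (simp add: norm_eq_1)
  have refl: "b x - (2 * (b x \<bullet> v)) *\<^sub>R v = 0"
    and eig: "jacobian b (at x) *v v = (v \<bullet> (jacobian b (at x) *v v)) *\<^sub>R v"
    using fp v by (auto simp: sgad_fixed_point_def ode_fixed_point_def sgad_def zero_prod_def)
  \<comment> \<open>Reflection flips the sign of the component along \<open>v\<close>, so this component vanishes first.\<close>
  have "b x \<bullet> v = 0"
    using arg_cong[OF refl, of "\<lambda>w. w \<bullet> v"] by (simp add: inner_diff_left vv)
  with refl show "b x = 0" by simp
  show "eigenvector_of (jacobian b (at x)) v (v \<bullet> (jacobian b (at x) *v v))"
    using eig fp by (simp add: eigenvector_of_def sgad_fixed_point_def scalar_mult_eq_scaleR)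
qed

lemma sgad_fixed_pointI:
  assumes "b x = 0" and "jacobian b (at x) *v v = l *\<^sub>R v" and "norm v = 1"
  shows "sgad_fixed_point b x v"
  using assms
  by (auto simp: sgad_fixed_point_def ode_fixed_point_def sgad_def zero_prod_def norm_eq_1)

text \<open>
  With a full set of eigenvectors a constant ranking will do: every basis vector is only scaled.
  Distinctness of the eigenvalues makes each a simple root. The unique root with positive real
  part in the index-1 condition must then be \<open>lam i\<close>, which rules out a zero eigenvalue as well.
\<close>

lemma index1_saddle_unique_positive_iff:
  fixes b :: "real^'n \<Rightarrow> real^'n" and lam :: "'n \<Rightarrow> real" and V :: "'n \<Rightarrow> real^'n"
  assumes b0: "b x = 0" and span: "span (range V) = UNIV" and inj: "inj lam"
    and eig: "\<And>j. jacobian b (at x) *v V j = lam j *\<^sub>R V j"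
  shows "index1_saddle b x \<and> {\<mu>. eigenvalue_of (jacobian b (at x)) \<mu> \<and> \<mu> > 0} = {lam i} \<longleftrightarrow>
    lam i > 0 \<and> (\<forall>j. j \<noteq> i \<longrightarrow> lam j < 0)"
proof -
  have flag: "jacobian b (at x) *v V k - lam k *\<^sub>R V k \<in> span (V ` {l. (0::nat) < 0})" for k
    by (simp add: eig)
  note eigenvalues = eigenvalue_of_flag[where r = "\<lambda>_. 0", OF span flag]
  have simple: "order (of_real (lam i)) (charpoly_of (complexify (jacobian b (at x)))) = 1"
    unfolding charpoly_of_flag(2)[where r = "\<lambda>_. 0", OF span flag]
    by (rule order_prod_distinct_linear) (use inj in \<open>auto simp: inj_def\<close>)
  have "index1_saddle b x \<longleftrightarrow> (\<exists>k. lam k > 0 \<and>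
      order (of_real (lam k)) (charpoly_of (complexify (jacobian b (at x)))) = 1 \<and>
      (\<forall>j. lam j \<noteq> lam k \<longrightarrow> lam j < 0))"
    using b0 unfolding index1_saddle_def ode_fixed_point_def eigenvalues(2) by fastforce
  moreover have "{\<mu>. eigenvalue_of (jacobian b (at x)) \<mu> \<and> \<mu> > 0} = {lam j |j. lam j > 0}"
    unfolding eigenvalues(1) by auto
  ultimately show ?thesis
    using simple inj by (auto simp: inj_eq set_eq_iff) (metis less_asym)+
qed

theorem theorem1:
  fixes b :: "real^'n \<Rightarrow> real^'n"
  assumes smooth: "smooth_map b"
  shows "(\<forall>x v. sgad_fixed_point b x v \<and> norm v = 1 \<longrightarrow>
            (\<exists>l. eigenvector_of (jacobian b (at x)) v l) \<and> ode_fixed_point b x)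
       \<and> (\<forall>xs (lam :: 'n \<Rightarrow> real) (V :: 'n \<Rightarrow> real^'n).
            ode_fixed_point b xs \<and> inj lam \<and> inj V \<and> independent (range V) \<and>
            (\<forall>i. eigenvector_of (jacobian b (at xs)) (V i) (lam i) \<and> norm (V i) = 1) \<longrightarrow>
            (\<forall>i. sgad_fixed_point b xs (V i)) \<and>
            (\<forall>i. sgad_linearly_stable b xs (V i) \<longleftrightarrow>
                   index1_saddle b xs \<and>
                   {\<mu>. eigenvalue_of (jacobian b (at xs)) \<mu> \<and> \<mu> > 0} = {lam i}))"
proof (intro conjI allI impI)
  fix x v assume "sgad_fixed_point b x v \<and> norm v = 1"
  then show "\<exists>l. eigenvector_of (jacobian b (at x)) v l" "ode_fixed_point b x"
    using sgad_fixed_pointD unfolding ode_fixed_point_def by blast+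
next
  fix xs and lam :: "'n \<Rightarrow> real" and V :: "'n \<Rightarrow> real^'n" and i
  assume "ode_fixed_point b xs \<and> inj lam \<and> inj V \<and> independent (range V) \<and>
    (\<forall>i. eigenvector_of (jacobian b (at xs)) (V i) (lam i) \<and> norm (V i) = 1)"
  then have b0: "b xs = 0" and inj: "inj lam" "inj V" and indep: "independent (range V)"
    and eig: "\<And>j. jacobian b (at xs) *v V j = lam j *\<^sub>R V j" and norm: "\<And>j. norm (V j) = 1"
    by (auto simp: ode_fixed_point_def eigenvector_of_def scalar_mult_eq_scaleR)
  show "sgad_fixed_point b xs (V i)"
    using sgad_fixed_pointI[of b, OF b0 eig norm] .
  have span: "span (range V) = UNIV"
    using card_ge_dim_independent[of "range V" UNIV] indep inj(2)
    by (auto simp: card_image)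
  have "sgad_linearly_stable b xs (V i) \<longleftrightarrow>
      (\<forall>j. (if j = i then - lam i else lam j) < 0 \<and>
           (if j = i then - 2 * lam i else lam j - lam i) < 0)"
    unfolding sgad_linearly_stable_def linearly_stable_def
      sgad_eigenvalues[OF smooth b0 span eig norm]
    by (metis Re_complex_of_real)
  also have "\<dots> \<longleftrightarrow> lam i > 0 \<and> (\<forall>j. j \<noteq> i \<longrightarrow> lam j < 0)"
    by (force split: if_splits)
  also have "\<dots> \<longleftrightarrow> index1_saddle b xs \<and>
      {\<mu>. eigenvalue_of (jacobian b (at xs)) \<mu> \<and> \<mu> > 0} = {lam i}"
    by (rule index1_saddle_unique_positive_iff[of b, OF b0 span inj(1) eig, symmetric])
  finally show "sgad_linearly_stable b xs (V i) \<longleftrightarrow> index1_saddle b xs \<and>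
      {\<mu>. eigenvalue_of (jacobian b (at xs)) \<mu> \<and> \<mu> > 0} = {lam i}" .
qed

end
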